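(* Let $Q_m(x)=\det(I_m-xB(m))$ for $m\ge 1$ and $Q_0(x)=1$, and let $R_m(x)=\det\begin{pmatrix}0&u^t\\-u&I_m-xB(m)\end{pmatrix}$ for $m\ge1$. Then: (1) $Q_0(x)=1$, $Q_1(x)=1-x$, and $Q_m(x)=-xQ_{m-1}(-x)+Q_{m-2}(x)$ for all $m\ge 2$; (2) $Q_m(x)Q_{m+1}(x)+Q_m(-x)Q_{m+1}(-x)=2$ for all $m\ge 0$; (3) $Q_{m+1}(x)Q_{m+1}(-x)-Q_{m+2}(x)Q_m(-x)=x$ for all $m\ge 0$; (4) $Q_m(x)+xR_m(x)=Q_{m-1}(-x)$ for all $m\ge 1$.
   Context: For a positive integer $m$, $B(m)=(b_{ij})_{1\le i,j\le m}$ is the $m\times m$ matrix with $b_{ij}=1$ if $i+j\le m+1$ and $b_{ij}=0$ otherwise. $I_m$ is the $m\times m$ identity matrix and $u=(1,\dots,1)^t\in\mathbb{R}^m$. The $Q_m$ and $R_m$ are polynomials in the indeterminate $x$. *)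

theory Defs
  imports "HOL-Computational_Algebra.Polynomial" "Jordan_Normal_Form.Determinant"
begin

text \<open>Matrix indices start at 0, so row \<open>i\<close> and column \<open>j\<close> stand for the
  one-based indices \<open>i + 1\<close> and \<open>j + 1\<close>.\<close>

definition B_mat :: "nat \<Rightarrow> real mat" where
  "B_mat m = mat m m (\<lambda>(i, j). if (i + 1) + (j + 1) \<le> m + 1 then 1 else 0)"

definition u_col :: "nat \<Rightarrow> real mat" where
  "u_col m = mat m 1 (\<lambda>_. 1)"

abbreviation const_mat :: "real mat \<Rightarrow> real poly mat" where
  "const_mat \<equiv> map_mat (\<lambda>a. [:a:])"

abbreviation X :: "real poly" where
  "X \<equiv> [:0, 1:]"

definition IxB :: "nat \<Rightarrow> real poly mat" where
  "IxB m = 1\<^sub>m m - X \<cdot>\<^sub>m const_mat (B_mat m)"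

definition Q :: "nat \<Rightarrow> real poly" where
  "Q m = (if m = 0 then 1 else det (IxB m))"

text \<open>Only the values for \<open>m \<ge> 1\<close> are meaningful.\<close>

definition R :: "nat \<Rightarrow> real poly" where
  "R m = det (four_block_mat
     (0\<^sub>m 1 1)                  (const_mat (transpose_mat (u_col m)))
     (- const_mat (u_col m))   (IxB m))"

text \<open>The substitution \<open>x \<mapsto> -x\<close>.\<close>

abbreviation neg_arg :: "real poly \<Rightarrow> real poly" where
  "neg_arg p \<equiv> p \<circ>\<^sub>p (- X)"

end

theory Submission
  imports Defs
begin

text \<open>Clearing the border of the matrix of \<open>R m\<close> gives
  \<open>Q m + x R m = det (I - x B + x J)\<close> with \<open>J\<close> the all-ones matrix. As \<open>J - B m\<close> has zero first
  row and column and reversing both index orders turns the rest of it into \<open>B (m - 1)\<close>, this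
  determinant is \<open>Q (m - 1)\<close> at \<open>-x\<close>. Eliminating the last row and column of \<open>I - x B (m + 2)\<close>
  leaves a bordered copy of \<open>I - x B m\<close>, so \<open>Q (m + 2) = (1 - x - x\<^sup>2) Q m - x\<^sup>2 R m\<close>.
  Together these two relations yield the recurrence by induction, and the quadratic identities
  follow from the recurrence.\<close>

section \<open>Determinants of block, bordered and index-reversed matrices\<close>

lemma add_minus_cancel_mat:
  fixes A :: "'a :: ab_group_add mat"
  assumes "A \<in> carrier_mat n m" "B \<in> carrier_mat n m"
  shows "B + (A - B) = A"
  using assms by (intro eq_matI) auto

text \<open>Block LU factorization: \<open>L\<close> is unit lower triangular, so the whole
  determinant sits in the Schur complement \<open>S\<close> of the identity block.\<close>

lemma det_four_block_mat_upper_left_one: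
  fixes D :: "'a :: idom mat"
  assumes B: "B \<in> carrier_mat k n" and C: "C \<in> carrier_mat n k" and D: "D \<in> carrier_mat n n"
  shows "det (four_block_mat (1\<^sub>m k) B C D) = det (D - C * B)"
proof -
  define S where "S = D - C * B"
  have CB: "C * B \<in> carrier_mat n n"
    using B C by simp
  then have S: "S \<in> carrier_mat n n"
    by (simp add: S_def minus_carrier_mat)
  have CBS: "C * B + S = D"
    unfolding S_def by (rule add_minus_cancel_mat[OF D CB])
  define L where "L = four_block_mat (1\<^sub>m k) (0\<^sub>m k n) C (1\<^sub>m n)"
  define U where "U = four_block_mat (1\<^sub>m k) B (0\<^sub>m n k) S"
  have "L * U = four_block_mat (1\<^sub>m k * 1\<^sub>m k + 0\<^sub>m k n * 0\<^sub>m n k) (1\<^sub>m k * B + 0\<^sub>m k n * S)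
      (C * 1\<^sub>m k + 1\<^sub>m n * 0\<^sub>m n k) (C * B + 1\<^sub>m n * S)"
    unfolding L_def U_def using B C S by (intro mult_four_block_mat) auto
  also have "\<dots> = four_block_mat (1\<^sub>m k) B C D"
    using B C S by (simp add: CBS)
  finally have "det (four_block_mat (1\<^sub>m k) B C D) = det (L * U)"
    by simp
  also have "\<dots> = det L * det U"
    unfolding L_def U_def using S by (intro det_mult[of _ "k + n"] four_block_carrier_mat) auto
  also have "det L = 1"
    unfolding L_def using C by (subst det_four_block_mat_upper_right_zero[of _ k _ n]) auto
  also have "det U = det S"
    unfolding U_def using B S by (subst det_four_block_mat_lower_left_zero[of _ k _ n]) auto
  finally show ?thesis
    by (simp add: S_def)
qed

text \<open>Mirror image of the previous factorization: eliminating the trailing identity block puts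
  the upper triangular factor first.\<close>

lemma det_four_block_mat_lower_right_one:
  fixes A :: "'a :: idom mat"
  assumes A: "A \<in> carrier_mat n n" and B: "B \<in> carrier_mat n k" and C: "C \<in> carrier_mat k n"
  shows "det (four_block_mat A B C (1\<^sub>m k)) = det (A - B * C)"
proof -
  define S where "S = A - B * C"
  have BC: "B * C \<in> carrier_mat n n"
    using B C by simp
  then have S: "S \<in> carrier_mat n n"
    by (simp add: S_def minus_carrier_mat)
  have SBC: "S + B * C = A"
    using add_minus_cancel_mat[OF A BC] comm_add_mat[OF S BC] by (simp add: S_def)
  define U where "U = four_block_mat S B (0\<^sub>m k n) (1\<^sub>m k)"
  define L where "L = four_block_mat (1\<^sub>m n) (0\<^sub>m n k) C (1\<^sub>m k)"
  have "U * L = four_block_mat (S * 1\<^sub>m n + B * C) (S * 0\<^sub>m n k + B * 1\<^sub>m k)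
      (0\<^sub>m k n * 1\<^sub>m n + 1\<^sub>m k * C) (0\<^sub>m k n * 0\<^sub>m n k + 1\<^sub>m k * 1\<^sub>m k)"
    unfolding L_def U_def using B C S by (intro mult_four_block_mat) auto
  also have "\<dots> = four_block_mat A B C (1\<^sub>m k)"
    using B C S by (simp add: SBC)
  finally have "det (four_block_mat A B C (1\<^sub>m k)) = det (U * L)"
    by simp
  also have "\<dots> = det U * det L"
    unfolding L_def U_def using S by (intro det_mult[of _ "n + k"] four_block_carrier_mat) auto
  also have "det U = det S"
    unfolding U_def using B S by (subst det_four_block_mat_lower_left_zero[of _ n _ k]) auto
  also have "det L = 1"
    unfolding L_def using C by (subst det_four_block_mat_upper_right_zero[of _ n _ k]) auto
  finally show ?thesis
    by (simp add: S_def)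
qed

text \<open>Expansion along row 0: its cofactors never see the corner, so the determinant is affine
  in \<open>a\<close>, with slope the cofactor \<open>det D\<close>.\<close>

lemma det_bordered_corner:
  fixes D :: "'a :: comm_ring_1 mat"
  assumes B: "B \<in> carrier_mat 1 n" and C: "C \<in> carrier_mat n 1" and D: "D \<in> carrier_mat n n"
  shows "det (four_block_mat (mat 1 1 (\<lambda>_. a)) B C D) =
    a * det D + det (four_block_mat (0\<^sub>m 1 1) B C D)"
proof -
  define M where "M a = four_block_mat (mat 1 1 (\<lambda>_. a)) B C D" for a
  have M: "M a \<in> carrier_mat (Suc n) (Suc n)" for a
    unfolding M_def using D by auto
  have cof: "cofactor (M a) 0 j = cofactor (M 0) 0 j" for a j
  proof -
    have "mat_delete (M a) 0 j = mat_delete (M 0) 0 j"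
      using B C D unfolding M_def mat_delete_def by (intro eq_matI) auto
    then show ?thesis by (simp add: cofactor_def)
  qed
  have cof0: "cofactor (M 0) 0 0 = det D"
  proof -
    have "mat_delete (M 0) 0 0 = D"
      using B C D unfolding M_def mat_delete_def by (intro eq_matI) auto
    then show ?thesis by (simp add: cofactor_def)
  qed
  have "det (M a) = a * det D + (\<Sum>j<n. B $$ (0, j) * cofactor (M 0) 0 (Suc j))" for a
  proof -
    have "M a $$ (0, 0) = a" "\<And>j. j < n \<Longrightarrow> M a $$ (0, Suc j) = B $$ (0, j)"
      using B C D by (auto simp: M_def)
    then show ?thesis
      by (subst laplace_expansion_row[OF M, of 0])
        (simp_all add: sum.lessThan_Suc_shift cof0 cof[of a] del: sum.lessThan_Suc)
  qed
  from this[of a] this[of 0] have "det (M a) = a * det D + det (M 0)"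
    by simp
  moreover have "mat 1 1 (\<lambda>_. 0) = (0\<^sub>m 1 1 :: 'a mat)"
    by (rule eq_matI) auto
  ultimately show ?thesis
    by (simp add: M_def)
qed

text \<open>Multiplying by diag(b, 1, ..., 1) on the left and diag(c, 1, ..., 1) on the right scales
  just the two borders, since the corner is zero.\<close>

lemma det_bordered_smult:
  fixes D :: "'a :: idom mat"
  assumes B: "B \<in> carrier_mat 1 n" and C: "C \<in> carrier_mat n 1" and D: "D \<in> carrier_mat n n"
  shows "det (four_block_mat (0\<^sub>m 1 1) (b \<cdot>\<^sub>m B) (c \<cdot>\<^sub>m C) D) =
    b * c * det (four_block_mat (0\<^sub>m 1 1) B C D)"
proof -
  define E :: "'a \<Rightarrow> 'a mat" where
    "E a = four_block_mat (a \<cdot>\<^sub>m 1\<^sub>m 1) (0\<^sub>m 1 n) (0\<^sub>m n 1) (1\<^sub>m n)" for a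
  define M where "M = four_block_mat (0\<^sub>m 1 1) B C D"
  have E: "E a \<in> carrier_mat (1 + n) (1 + n)" for a
    unfolding E_def by (rule four_block_carrier_mat) simp_all
  have M: "M \<in> carrier_mat (1 + n) (1 + n)"
    unfolding M_def using D by (intro four_block_carrier_mat) auto
  have det_E: "det (E a) = a" for a
    unfolding E_def by (subst det_four_block_mat_upper_right_zero[of _ 1 _ n]) auto
  have "E b * M = four_block_mat (0\<^sub>m 1 1) (b \<cdot>\<^sub>m B) C D"
    unfolding E_def M_def using B C D
    by (subst mult_four_block_mat[of _ 1 1 _ n _ n _ _ 1 _ n])
      (auto intro!: cong_four_block_mat)
  also have "\<dots> * E c = four_block_mat (0\<^sub>m 1 1) (b \<cdot>\<^sub>m B) (c \<cdot>\<^sub>m C) D"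
    unfolding E_def using B C D
    by (subst mult_four_block_mat[of _ 1 1 _ n _ n _ _ 1 _ n])
      (auto intro!: cong_four_block_mat)
  finally have "four_block_mat (0\<^sub>m 1 1) (b \<cdot>\<^sub>m B) (c \<cdot>\<^sub>m C) D = E b * M * E c" ..
  then show ?thesis
    by (simp only: det_mult[OF mult_carrier_mat[OF E M] E] det_mult[OF E M] det_E ac_simps flip: M_def)
qed

text \<open>Rows and columns undergo the same permutation, so its sign enters twice and squares to
  1.\<close>

lemma det_reverse_rows_cols:
  fixes f :: "nat \<Rightarrow> nat \<Rightarrow> 'a :: comm_ring_1"
  shows "det (mat n n (\<lambda>(i, j). f (n - 1 - i) (n - 1 - j))) = det (mat n n (\<lambda>(i, j). f i j))"
proof -
  define p where "p i = (if i < n then n - 1 - i else i)" for i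
  have p: "p permutes {0..<n}"
    \<comment> \<open>On the indices below \<open>n\<close> the reversal is its own inverse.\<close>
    by (rule bij_imp_permutes) (auto simp: p_def intro!: bij_betwI[of _ _ _ p])
  have reverse: "det (mat n n (\<lambda>(i, j). g (n - 1 - i) j)) = signof p * det (mat n n (\<lambda>(i, j). g i j))"
    for g :: "nat \<Rightarrow> nat \<Rightarrow> 'a"
  proof -
    have "mat n n (\<lambda>(i, j). g (n - 1 - i) j) =
        mat n n (\<lambda>(i, j). mat n n (\<lambda>(i, j). g i j) $$ (p i, j))"
      by (rule eq_matI) (auto simp: p_def)
    then show ?thesis
      using det_permute_rows[OF _ p, of "mat n n (\<lambda>(i, j). g i j)"] by simp
  qed
  have transp: "det (mat n n (\<lambda>(i, j). g i j)) = det (mat n n (\<lambda>(i, j). g j i))"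
    for g :: "nat \<Rightarrow> nat \<Rightarrow> 'a"
  proof -
    have "transpose_mat (mat n n (\<lambda>(i, j). g i j)) = mat n n (\<lambda>(i, j). g j i)"
      by (rule eq_matI) auto
    then show ?thesis
      by (metis det_transpose mat_carrier)
  qed
  have "det (mat n n (\<lambda>(i, j). f (n - 1 - i) (n - 1 - j)))
      = signof p * det (mat n n (\<lambda>(i, j). f i (n - 1 - j)))"
    by (rule reverse)
  \<comment> \<open>Column reversal is row reversal between two transpositions.\<close>
  also have "det (mat n n (\<lambda>(i, j). f i (n - 1 - j))) = signof p * det (mat n n (\<lambda>(i, j). f i j))"
    using transp[of "\<lambda>i j. f i (n - 1 - j)"] reverse[of "\<lambda>i j. f j i"] transp[of f] by simp
  also have "signof p * (signof p * det (mat n n (\<lambda>(i, j). f i j))) = det (mat n n (\<lambda>(i, j). f i j))"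
    by (simp add: sign_def)
  finally show ?thesis .
qed

section \<open>The substitution x -> -x and the entries of I - x B\<close>

lemma comm_ring_hom_neg_arg: "comm_ring_hom neg_arg"
  by standard (simp_all add: pcompose_add pcompose_mult pcompose_1)

lemma neg_arg_X [simp]: "neg_arg X = - X"
  by (simp add: pcompose_pCons)

lemma neg_arg_neg_arg [simp]: "neg_arg (neg_arg p) = p"
  by (simp add: pcompose_assoc[symmetric] pcompose_pCons pcompose_uminus)

text \<open>In zero-based indices, \<open>(i + 1) + (j + 1) \<le> m + 1\<close> becomes
  \<open>i + j < m\<close>.\<close>

lemma IxB_eq: "IxB m = mat m m (\<lambda>(i, j). (if i = j then 1 else 0) - (if i + j < m then X else 0))"
  by (rule eq_matI) (auto simp: IxB_def B_mat_def)

lemma IxB_carrier [simp]: "IxB m \<in> carrier_mat m m"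
  by (simp add: IxB_eq)

lemma Q_eq: "Q m = det (IxB m)"
  by (cases "m = 0") (simp_all add: Q_def)

lemma neg_arg_Q:
  "neg_arg (Q m) = det (mat m m (\<lambda>(i, j). (if i = j then 1 else 0) + (if i + j < m then X else 0)))"
proof -
  interpret comm_ring_hom neg_arg by (rule comm_ring_hom_neg_arg)
  have "map_mat neg_arg (IxB m) =
      mat m m (\<lambda>(i, j). (if i = j then 1 else 0) + (if i + j < m then X else 0))"
    by (rule eq_matI) (auto simp: IxB_eq pcompose_diff pcompose_pCons pcompose_1)
  then show ?thesis
    by (metis Q_eq hom_det)
qed

section \<open>Bordered matrices and two relations between \<open>Q\<close> and
  \<open>R\<close>\<close>

definition ones_row :: "nat \<Rightarrow> real poly mat" where
  "ones_row m = mat 1 m (\<lambda>_. 1)"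

definition ones_col :: "nat \<Rightarrow> real poly mat" where
  "ones_col m = mat m 1 (\<lambda>_. 1)"

lemma ones_carrier [simp]: "ones_row m \<in> carrier_mat 1 m" "ones_col m \<in> carrier_mat m 1"
  by (simp_all add: ones_row_def ones_col_def)

text \<open>The common form to which both eliminations below are reduced. The minus sign arises
  because the borders in \<open>R\<close> are \<open>u\<close> transposed and \<open>-u\<close>, of
  opposite sign.\<close>

lemma det_bordered_IxB:
  "det (four_block_mat (mat 1 1 (\<lambda>_. a)) (b \<cdot>\<^sub>m ones_row m) (c \<cdot>\<^sub>m ones_col m) (IxB m)) =
    a * Q m - b * c * R m"
proof -
  have "const_mat (transpose_mat (u_col m)) = 1 \<cdot>\<^sub>m ones_row m"
    by (rule eq_matI) (auto simp: u_col_def ones_row_def)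
  moreover have "- const_mat (u_col m) = (- 1) \<cdot>\<^sub>m ones_col m"
    by (rule eq_matI) (auto simp: u_col_def ones_col_def one_pCons)
  ultimately have "R m = - det (four_block_mat (0\<^sub>m 1 1) (ones_row m) (ones_col m) (IxB m))"
    unfolding R_def by (simp only: det_bordered_smult[OF ones_carrier IxB_carrier])
  then show ?thesis
    by (simp add: det_bordered_corner[OF smult_carrier_mat smult_carrier_mat IxB_carrier, OF ones_carrier]
        det_bordered_smult[OF ones_carrier IxB_carrier] Q_eq del: One_nat_def)
qed

lemma Q_plus_X_R: "Q (Suc m) + X * R (Suc m) = neg_arg (Q m)"
proof -
  let ?n = "Suc m"
  let ?D = "mat m m (\<lambda>(i, j). (if i = j then 1 else 0) + (if m \<le> Suc (i + j) then X else 0))"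
  \<comment> \<open>Corner 1 and border factors \<open>X\<close> and \<open>- 1\<close> turn
    \<open>a * Q - b * c * R\<close> into the left-hand side.\<close>
  have "Q ?n + X * R ?n =
      det (four_block_mat (mat 1 1 (\<lambda>_. 1)) (X \<cdot>\<^sub>m ones_row ?n) ((- 1) \<cdot>\<^sub>m ones_col ?n) (IxB ?n))"
    unfolding det_bordered_IxB by simp
  also have "mat 1 1 (\<lambda>_. 1) = (1\<^sub>m 1 :: real poly mat)"
    by (rule eq_matI) auto
  also have "det (four_block_mat (1\<^sub>m 1) (X \<cdot>\<^sub>m ones_row ?n) ((- 1) \<cdot>\<^sub>m ones_col ?n) (IxB ?n)) =
      det (IxB ?n - ((- 1) \<cdot>\<^sub>m ones_col ?n) * (X \<cdot>\<^sub>m ones_row ?n))"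
    by (rule det_four_block_mat_upper_left_one[of _ _ ?n])
      (simp_all only: smult_carrier_mat ones_carrier IxB_carrier)
  \<comment> \<open>Adding \<open>X\<close> everywhere cancels it where \<open>i + j < ?n\<close>,
    in particular in all of row 0 and column 0. In the remaining block both indices shift by one,
    which gives \<open>m \<le> Suc (i + j)\<close>.\<close>
  also have "IxB ?n - ((- 1) \<cdot>\<^sub>m ones_col ?n) * (X \<cdot>\<^sub>m ones_row ?n) =
      four_block_mat (1\<^sub>m 1) (0\<^sub>m 1 m) (0\<^sub>m m 1) ?D"
    by (rule eq_matI) (auto simp: IxB_eq ones_row_def ones_col_def scalar_prod_def)
  also have "det \<dots> = det ?D"
    by (subst det_four_block_mat_upper_right_zero[of _ 1 _ m]) simp_all
  also have "?D = mat m m (\<lambda>(i, j). (if m - 1 - i = m - 1 - j then 1 else 0) +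
      (if (m - 1 - i) + (m - 1 - j) < m then X else 0))"
    by (rule eq_matI) auto
  also have "det \<dots> = neg_arg (Q m)"
    unfolding neg_arg_Q
    by (rule det_reverse_rows_cols[of m "\<lambda>i j. (if i = j then 1 else 0) + (if i + j < m then X else 0)"])
  finally show ?thesis .
qed

lemma Q_Suc_Suc_R: "Q (Suc (Suc m)) = (1 - X - X\<^sup>2) * Q m - X\<^sup>2 * R m"
proof -
  let ?n = "Suc m"
  let ?A = "mat ?n ?n (\<lambda>(i, j). (if i = j then 1 else 0) - (if i + j < Suc ?n then X else 0))"
  let ?B = "mat ?n 1 (\<lambda>(i, j). if i = 0 then - X else 0)"
  let ?C = "mat 1 ?n (\<lambda>(i, j). if j = 0 then - X else 0)"
  \<comment> \<open>Off the diagonal, the last row and column meet the support of B only at index 0;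
    their diagonal entry is 1.\<close>
  have "IxB (Suc ?n) = four_block_mat ?A ?B ?C (1\<^sub>m 1)"
    by (rule eq_matI) (auto simp: IxB_eq)
  then have "Q (Suc ?n) = det (?A - ?B * ?C)"
    by (simp only: Q_eq) (rule det_four_block_mat_lower_right_one[of _ ?n], simp_all)
  \<comment> \<open>The product \<open>?B * ?C\<close> changes only the corner, by
    \<open>X\<^sup>2\<close>. Away from row 0 and column 0, the index shift turns
    \<open>i + j < m + 2\<close> into \<open>i + j < m\<close>.\<close>
  also have "?A - ?B * ?C = four_block_mat (mat 1 1 (\<lambda>_. 1 - X - X\<^sup>2))
      ((- X) \<cdot>\<^sub>m ones_row m) ((- X) \<cdot>\<^sub>m ones_col m) (IxB m)"
    by (rule eq_matI)
      (auto simp: IxB_eq ones_row_def ones_col_def scalar_prod_def power2_eq_square)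
  also have "det \<dots> = (1 - X - X\<^sup>2) * Q m - X\<^sup>2 * R m"
    unfolding det_bordered_IxB by (simp only: power2_eq_square minus_mult_minus)
  finally show ?thesis .
qed

section \<open>The recurrence and the quadratic identities\<close>

lemma Q_0: "Q 0 = 1"
  by (simp add: Q_def)

lemma Q_1: "Q (Suc 0) = 1 - X"
  by (simp add: Q_eq IxB_eq det_single)

text \<open>The base case of the recurrence uses \<open>Q_Suc_Suc_R\<close> at \<open>m = 0\<close>,
  where the bordered matrix is only its zero corner.\<close>

lemma R_0: "R 0 = 0"
proof -
  have "four_block_mat (0\<^sub>m 1 1) (const_mat (transpose_mat (u_col 0))) (- const_mat (u_col 0)) (IxB 0)
      = 0\<^sub>m 1 1"
    by (rule eq_matI) (auto simp: u_col_def IxB_eq)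
  then show ?thesis
    unfolding R_def by simp
qed

lemma neg_arg_recurrence: "neg_arg (- X * neg_arg p + q) = X * p + neg_arg q"
  by (simp only: pcompose_add pcompose_mult pcompose_uminus neg_arg_X neg_arg_neg_arg minus_minus)

lemma Q_recurrence: "Q (Suc (Suc m)) = - X * neg_arg (Q (Suc m)) + Q m"
proof (induction m)
  case 0
  have "neg_arg (1 - X) = 1 + X"
    by (simp only: pcompose_diff pcompose_1 neg_arg_X diff_minus_eq_add)
  then show ?case
    by (simp add: Q_Suc_Suc_R R_0 Q_0 Q_1 power2_eq_square algebra_simps)
next
  case (Suc m)
  have neg_Q: "neg_arg (Q (Suc (Suc m))) = X * Q (Suc m) + neg_arg (Q m)"
    unfolding Suc.IH by (rule neg_arg_recurrence)
  \<comment> \<open>Here \<open>a\<close> is \<open>Q (Suc m)\<close>, \<open>r\<close> is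
    \<open>R (Suc m)\<close> and \<open>p\<close> is \<open>neg_arg (Q m)\<close>. Substituting
    \<open>x * r = p - a\<close> eliminates \<open>r\<close>, and the reflected induction hypothesis
    identifies \<open>x * a + p\<close>.\<close>
  have "c = - x * (x * a + p) + a"
    if "c = (1 - x - x\<^sup>2) * a - x\<^sup>2 * r" "a + x * r = p" for a c p r x :: "real poly"
    by (simp add: that(1) that(2)[symmetric] algebra_simps power2_eq_square)
  from this[OF Q_Suc_Suc_R Q_plus_X_R] show ?case
    by (simp only: neg_Q)
qed

lemma neg_arg_Q_recurrence: "neg_arg (Q (Suc (Suc m))) = X * Q (Suc m) + neg_arg (Q m)"
  unfolding Q_recurrence by (rule neg_arg_recurrence)

lemma Q_Q_sum: "Q m * Q (Suc m) + neg_arg (Q m) * neg_arg (Q (Suc m)) = 2"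
proof (induction m)
  case 0
  show ?case
    by (simp add: Q_0 Q_1 pcompose_diff pcompose_pCons pcompose_1)
next
  case (Suc m)
  \<comment> \<open>The terms \<open>x * b * b'\<close> cancel, so the sum does not depend on
    \<open>m\<close>; its initial value is (1 - x) + (1 + x).\<close>
  have "b * c + b' * c' = 2"
    if "a * b + a' * b' = 2" "c = - x * b' + a" "c' = x * b + a'"
    for a a' b b' c c' x :: "real poly"
    using that(1) by (simp add: that(2,3) algebra_simps)
  from this[OF Suc.IH Q_recurrence neg_arg_Q_recurrence] show ?case .
qed

lemma Q_Q_diff: "Q (Suc m) * neg_arg (Q (Suc m)) - Q (Suc (Suc m)) * neg_arg (Q m) = X"
proof (induction m)
  case 0
  have "(1 - x) * (1 + x) - (- x * (1 + x) + 1) * 1 = x" for x :: "real poly"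
    by (simp add: algebra_simps)
  moreover have "neg_arg (1 - X) = 1 + X"
    by (simp only: pcompose_diff pcompose_1 neg_arg_X diff_minus_eq_add)
  ultimately show ?case
    by (simp only: Q_recurrence Q_0 Q_1 pcompose_1)
next
  case (Suc m)
  let ?d = "Q (Suc m) * neg_arg (Q (Suc m)) - Q (Suc (Suc m)) * neg_arg (Q m)"
  \<comment> \<open>Reflecting the induction hypothesis flips the sign of \<open>X\<close> and pairs
    \<open>neg_arg (Q (Suc (Suc m)))\<close> with \<open>Q m\<close>, as the next step
    requires.\<close>
  have "neg_arg ?d = neg_arg (Q (Suc m)) * Q (Suc m) - neg_arg (Q (Suc (Suc m))) * Q m"
    by (simp only: pcompose_diff pcompose_mult neg_arg_neg_arg)
  then have neg_IH: "neg_arg (Q (Suc m)) * Q (Suc m) - neg_arg (Q (Suc (Suc m))) * Q m = - X"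
    by (simp only: Suc.IH neg_arg_X)
  \<comment> \<open>Expanding \<open>c\<close> and \<open>d\<close> cancels
    \<open>x * b' * c'\<close> and leaves \<open>a * c' - b * b'\<close>, the negative of the
    reflected hypothesis.\<close>
  have "c * c' - d * b' = x"
    if "b' * b - c' * a = - x" "c = - x * b' + a" "d = - x * c' + b" for a b b' c c' d x :: "real poly"
    using that(1) by (simp add: that(2,3) algebra_simps)
  from this[OF neg_IH Q_recurrence Q_recurrence] show ?case .
qed

theorem theorem3:
  shows "(Q 0 = 1 \<and> Q 1 = 1 - X \<and>
      (\<forall>m\<ge>2. Q m = - X * neg_arg (Q (m - 1)) + Q (m - 2))) \<and>
    (\<forall>m. Q m * Q (m + 1) + neg_arg (Q m) * neg_arg (Q (m + 1)) = 2) \<and>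
    (\<forall>m. Q (m + 1) * neg_arg (Q (m + 1)) - Q (m + 2) * neg_arg (Q m) = X) \<and>
    (\<forall>m\<ge>1. Q m + X * R m = neg_arg (Q (m - 1)))"
proof -
  have "Q m = - X * neg_arg (Q (m - 1)) + Q (m - 2)" if "m \<ge> 2" for m
    using Q_recurrence[of "m - 2"] that by (simp add: numeral_2_eq_2 Suc_diff_Suc)
  moreover have "Q m + X * R m = neg_arg (Q (m - 1))" if "m \<ge> 1" for m
    using Q_plus_X_R[of "m - 1"] that by simp
  ultimately show ?thesis
    using Q_0 Q_1 Q_Q_sum Q_Q_diff by simp
qed

end
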